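(* Let $d\in\mathbb{N}$ with $d\ge 2$, let $0<\pi<1$, let $\chi$ be the probability distribution with $\chi(0)=1-\pi$ and $\chi(d)=\pi$, and let $(p,q)\in[0,1]^2$ with $0<p+q<1$. The probability that the bond percolation game with parameter-pair $(p,q)$, played on the rooted Galton-Watson tree $T_\chi$ starting from its root, results in a draw is $0$ if and only if $$(1-p-q)\,\pi\,\{\pi(1-q)+p(1-\pi)\}^{d-1}\le \frac{(d+1)^{d-1}}{d^{d}}.$$
   Context: Here $\pi$ is a parameter (not the circle constant). $T_\chi$ is the rooted Galton-Watson tree with root $\phi$ in which the numbers of children of the vertices are i.i.d. with law $\chi$. Each edge $\{u,v\}$ ($u$ the parent of $v$) is directed from $u$ to $v$. Bond percolation game with parameter-pair $(p,q)$: given $T_\chi$, each edge is independently labeled trap with probability $p$, target with probability $q$, safe with probability $1-p-q$. The tree and all labels are revealed to both players (perfect information). Two players alternately move a token, initially at $\phi$; a move takes the token from its current vertex $u$ along a directed edge to a child of $u$. A player who moves the token along a target edge wins immediately; a player who moves it along a trap edge loses immediately; a player whose turn it is to move when the token is at a leaf (childless vertex) loses. If the game continues forever it is a draw. Both players play optimally: for a given realization, the game is won (respectively lost) by the first player if the first (respectively second) player has a strategy guaranteeing a win for herself in finitely many rounds against any play of the opponent; otherwise the game results in a draw. *)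

theory Defs
  imports "HOL-Probability.Probability"
begin

text \<open>
  Vertices are Ulam--Harris addresses: the root is \<open>[]\<close> and the children of \<open>v\<close> are
  \<open>v @ [0], \<dots>, v @ [N v - 1]\<close>, where \<open>N\<close> gives the numbers of children. The edge from \<open>v\<close> to a
  child \<open>w\<close> is identified with its lower endpoint \<open>w\<close>, so a labelling \<open>L\<close> assigns the label of
  that edge to \<open>w\<close>. Values of \<open>N\<close> and \<open>L\<close> at addresses outside the tree grown from the root
  are never consulted by the game.
\<close>

type_synonym vertex = "nat list"

datatype edge_label = Trap | Target | Safe

datatype player = First | Second

definition children :: "(vertex \<Rightarrow> nat) \<Rightarrow> vertex \<Rightarrow> vertex set" where
  "children N v = {v @ [i] | i. i < N v}"

text \<open>
  In a tree the current vertex determines the history of the play, so a strategy may be taken to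
  be a function of the current vertex. Its value at a leaf is arbitrary and plays no role.
\<close>

definition strategy :: "(vertex \<Rightarrow> nat) \<Rightarrow> (vertex \<Rightarrow> vertex) \<Rightarrow> bool" where
  "strategy N s \<longleftrightarrow> (\<forall>v. children N v \<noteq> {} \<longrightarrow> s v \<in> children N v)"

text \<open>Rounds are numbered from 0; \<open>mover n\<close> is the player whose turn it is in round \<open>n\<close>.\<close>

definition mover :: "nat \<Rightarrow> player" where
  "mover n = (if even n then First else Second)"

text \<open>
  \<open>token s1 s2 n\<close> is the position at the start of round \<open>n\<close>. It is meaningful only as long as no
  earlier round has ended the game.
\<close>

primrec token :: "(vertex \<Rightarrow> vertex) \<Rightarrow> (vertex \<Rightarrow> vertex) \<Rightarrow> nat \<Rightarrow> vertex" where
  "token s1 s2 0 = []"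
| "token s1 s2 (Suc n) = (if mover n = First then s1 else s2) (token s1 s2 n)"

definition mover_wins_round ::
  "(vertex \<Rightarrow> nat) \<Rightarrow> (vertex \<Rightarrow> edge_label) \<Rightarrow> (vertex \<Rightarrow> vertex) \<Rightarrow> (vertex \<Rightarrow> vertex) \<Rightarrow> nat \<Rightarrow> bool"
where
  "mover_wins_round N L s1 s2 n \<longleftrightarrow>
     children N (token s1 s2 n) \<noteq> {} \<and> L (token s1 s2 (Suc n)) = Target"

definition mover_loses_round ::
  "(vertex \<Rightarrow> nat) \<Rightarrow> (vertex \<Rightarrow> edge_label) \<Rightarrow> (vertex \<Rightarrow> vertex) \<Rightarrow> (vertex \<Rightarrow> vertex) \<Rightarrow> nat \<Rightarrow> bool"
where
  "mover_loses_round N L s1 s2 n \<longleftrightarrow>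
     children N (token s1 s2 n) = {} \<or> L (token s1 s2 (Suc n)) = Trap"

definition play_won_by ::
  "player \<Rightarrow> (vertex \<Rightarrow> nat) \<Rightarrow> (vertex \<Rightarrow> edge_label) \<Rightarrow> (vertex \<Rightarrow> vertex) \<Rightarrow> (vertex \<Rightarrow> vertex) \<Rightarrow> bool"
where
  "play_won_by P N L s1 s2 \<longleftrightarrow>
     (\<exists>n. (\<forall>m<n. \<not> mover_wins_round N L s1 s2 m \<and> \<not> mover_loses_round N L s1 s2 m) \<and>
          (mover n = P \<and> mover_wins_round N L s1 s2 n \<or>
           mover n \<noteq> P \<and> mover_loses_round N L s1 s2 n))"

definition game_won :: "(vertex \<Rightarrow> nat) \<Rightarrow> (vertex \<Rightarrow> edge_label) \<Rightarrow> bool" where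
  "game_won N L \<longleftrightarrow>
     (\<exists>s1. strategy N s1 \<and> (\<forall>s2. strategy N s2 \<longrightarrow> play_won_by First N L s1 s2))"

definition game_lost :: "(vertex \<Rightarrow> nat) \<Rightarrow> (vertex \<Rightarrow> edge_label) \<Rightarrow> bool" where
  "game_lost N L \<longleftrightarrow>
     (\<exists>s2. strategy N s2 \<and> (\<forall>s1. strategy N s1 \<longrightarrow> play_won_by Second N L s1 s2))"

definition game_draw :: "(vertex \<Rightarrow> nat) \<Rightarrow> (vertex \<Rightarrow> edge_label) \<Rightarrow> bool" where
  "game_draw N L \<longleftrightarrow> \<not> game_won N L \<and> \<not> game_lost N L"

definition label_pmf :: "real \<Rightarrow> real \<Rightarrow> edge_label pmf" where
  "label_pmf p q = embed_pmf (\<lambda>l. case l of Trap \<Rightarrow> p | Target \<Rightarrow> q | Safe \<Rightarrow> 1 - p - q)"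

text \<open>Outside the range of parameters below, \<^const>\<open>label_pmf\<close> is unspecified.\<close>

lemma pmf_label_pmf:
  assumes "0 \<le> p" "0 \<le> q" "p + q \<le> 1"
  shows "pmf (label_pmf p q) l = (case l of Trap \<Rightarrow> p | Target \<Rightarrow> q | Safe \<Rightarrow> 1 - p - q)"
proof -
  have U: "(UNIV :: edge_label set) = {Trap, Target, Safe}"
    by (auto intro: edge_label.exhaust)
  show ?thesis
    unfolding label_pmf_def
  proof (rule pmf_embed_pmf)
    show "0 \<le> (case x of Trap \<Rightarrow> p | Target \<Rightarrow> q | Safe \<Rightarrow> 1 - p - q)" for x
      using assms by (cases x) auto
    show "(\<integral>\<^sup>+ x. ennreal (case x of Trap \<Rightarrow> p | Target \<Rightarrow> q | Safe \<Rightarrow> 1 - p - q)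
            \<partial>count_space UNIV) = 1"
      unfolding U using assms
      by (subst nn_integral_count_space_finite) (auto simp flip: ennreal_plus)
  qed
qed

text \<open>
  The first factor gives i.i.d. numbers of children with law \<open>offspring\<close>, that is, the Galton--Watson tree;
  the second, independent of the first, gives i.i.d. edge labels.
\<close>

definition game_space ::
  "nat pmf \<Rightarrow> real \<Rightarrow> real \<Rightarrow> ((vertex \<Rightarrow> nat) \<times> (vertex \<Rightarrow> edge_label)) measure"
where
  "game_space offspring p q =
     (\<Pi>\<^sub>M v\<in>UNIV. measure_pmf offspring) \<Otimes>\<^sub>M (\<Pi>\<^sub>M v\<in>UNIV. measure_pmf (label_pmf p q))"

definition draw_event ::
  "nat pmf \<Rightarrow> real \<Rightarrow> real \<Rightarrow> ((vertex \<Rightarrow> nat) \<times> (vertex \<Rightarrow> edge_label)) set"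
where
  "draw_event offspring p q = {(N, L) \<in> space (game_space offspring p q). game_draw N L}"

end

theory Submission imports Defs begin

text \<open>
  Let \<open>w\<close> and \<open>l\<close> be the probabilities that the first player can force a win, respectively a loss,
  within \<open>n\<close> rounds, and put \<open>r = 1 - p - q\<close>. Branching at the root shows that \<open>t = p + r * w\<close> and
  \<open>s = 1 - q - r * l\<close> evolve by \<open>(t, s) \<mapsto> (F s, F t)\<close> from \<open>(p, 1 - q)\<close>, where
  \<open>F y = c - b * y ^ d\<close> with \<open>b = r * \<pi>\<close> and \<open>c = p + r * \<pi>\<close>. The draw probability is
  \<open>1 / r\<close> times the limit of \<open>s - t\<close>, so it is positive iff the decreasing map \<open>F\<close> has a 2-cycle
  in \<open>[p, 1 - q]\<close>. If \<open>F\<close> has slope below \<open>-1\<close> at its fixed point, the fixed point repels under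
  \<open>F \<circ> F\<close> and the intermediate value theorem yields a 2-cycle; otherwise a power mean inequality
  excludes one. The stated inequality says that this slope is at least \<open>-1\<close>.
\<close>

subsection \<open>Determinacy by bounded-round wins and losses\<close>

text \<open>Both predicates speak about the player to move at \<open>v\<close>. A leaf needs no case
  of its own: over an empty set of children the existential quantifier fails and the universal one
  holds.\<close>

fun wins loses :: "nat \<Rightarrow> (vertex \<Rightarrow> nat) \<Rightarrow> (vertex \<Rightarrow> edge_label) \<Rightarrow> vertex \<Rightarrow> bool" where
  "wins 0 N L v = False"
| "wins (Suc n) N L v = (\<exists>w\<in>children N v. L w = Target \<or> L w = Safe \<and> loses n N L w)"
| "loses 0 N L v = False"
| "loses (Suc n) N L v = (\<forall>w\<in>children N v. L w = Trap \<or> L w = Safe \<and> wins n N L w)"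

lemma wins_loses_Suc:
  "(wins n N L v \<longrightarrow> wins (Suc n) N L v) \<and> (loses n N L v \<longrightarrow> loses (Suc n) N L v)"
proof (induction n arbitrary: v)
  case (Suc n)
  then show ?case
    by (metis wins.simps(2) loses.simps(2))
qed simp

lemma wins_mono: "m \<le> n \<Longrightarrow> wins m N L v \<Longrightarrow> wins n N L v"
  by (induction n rule: dec_induct) (use wins_loses_Suc in blast)+

lemma loses_mono: "m \<le> n \<Longrightarrow> loses m N L v \<Longrightarrow> loses n N L v"
  by (induction n rule: dec_induct) (use wins_loses_Suc in blast)+

lemma not_wins_and_loses: "\<not> (wins n N L v \<and> loses n N L v)"
proof (induction n arbitrary: v)
  case (Suc n)
  show ?case
  proof
    assume *: "wins (Suc n) N L v \<and> loses (Suc n) N L v"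
    then obtain w where w: "w \<in> children N v" "L w = Target \<or> L w = Safe \<and> loses n N L w"
      by auto
    moreover have "L w = Trap \<or> L w = Safe \<and> wins n N L w"
      using * w(1) by auto
    ultimately show False
      using Suc.IH[of w] by auto
  qed
qed simp

lemma finite_children: "finite (children N v)"
  by (simp add: children_def)

text \<open>One strategy must serve all round bounds at once. At each vertex the child is chosen for
  the least bound that permits a win; monotonicity of \<open>loses\<close> carries the choice to all
  larger bounds.\<close>

lemma attacking_strategy_exists:
  "\<exists>s. strategy N s \<and>
     (\<forall>v n. wins (Suc n) N L v \<longrightarrow> L (s v) = Target \<or> L (s v) = Safe \<and> loses n N L (s v))"
proof -
  have "\<exists>w. (children N v \<noteq> {} \<longrightarrow> w \<in> children N v) \<and>
     (\<forall>n. wins (Suc n) N L v \<longrightarrow> L w = Target \<or> L w = Safe \<and> loses n N L w)" for v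
  proof (cases "\<exists>n. wins (Suc n) N L v")
    case True
    define k where "k = (LEAST n. wins (Suc n) N L v)"
    have "wins (Suc k) N L v"
      using True unfolding k_def by (rule LeastI_ex)
    then obtain w where w: "w \<in> children N v" "L w = Target \<or> L w = Safe \<and> loses k N L w"
      by auto
    moreover have "k \<le> n" if "wins (Suc n) N L v" for n
      using that unfolding k_def by (rule Least_le)
    ultimately show ?thesis
      using loses_mono by blast
  next
    case False
    then show ?thesis by blast
  qed
  then obtain s where "\<forall>v. (children N v \<noteq> {} \<longrightarrow> s v \<in> children N v) \<and>
     (\<forall>n. wins (Suc n) N L v \<longrightarrow> L (s v) = Target \<or> L (s v) = Safe \<and> loses n N L (s v))"
    by metis
  then show ?thesis
    unfolding strategy_def by blast
qed

text \<open>Finite branching lets the second alternative hold for all \<open>n\<close> at once.\<close>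

lemma defending_strategy_exists:
  "\<exists>s. strategy N s \<and> (\<forall>v. (\<forall>n. \<not> loses n N L v) \<longrightarrow>
     L (s v) = Target \<or> L (s v) = Safe \<and> (\<forall>n. \<not> wins n N L (s v)))"
proof -
  have "\<exists>w. (children N v \<noteq> {} \<longrightarrow> w \<in> children N v) \<and> ((\<forall>n. \<not> loses n N L v) \<longrightarrow>
     L w = Target \<or> L w = Safe \<and> (\<forall>n. \<not> wins n N L w))" for v
  proof (cases "\<forall>n. \<not> loses n N L v")
    case True
    have "\<exists>w\<in>children N v. L w = Target \<or> L w = Safe \<and> (\<forall>n. \<not> wins n N L w)"
    proof (rule ccontr)
      assume *: "\<not> ?thesis"
      have "\<forall>w\<in>children N v. \<exists>n. L w = Trap \<or> L w = Safe \<and> wins n N L w"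
        using * edge_label.exhaust by metis
      then obtain h where h: "\<forall>w\<in>children N v. L w = Trap \<or> L w = Safe \<and> wins (h w) N L w"
        by metis
      have "h w \<le> Max (h ` children N v)" if "w \<in> children N v" for w
        using that by (simp add: finite_children)
      then have "loses (Suc (Max (h ` children N v))) N L v"
        using h wins_mono by (metis loses.simps(2))
      with True show False by blast
    qed
    then show ?thesis by blast
  qed auto
  then obtain s where "\<forall>v. (children N v \<noteq> {} \<longrightarrow> s v \<in> children N v) \<and> ((\<forall>n. \<not> loses n N L v) \<longrightarrow>
     L (s v) = Target \<or> L (s v) = Safe \<and> (\<forall>n. \<not> wins n N L (s v)))"
    by metis
  then show ?thesis
    unfolding strategy_def by blast
qed

lemma mover_Suc: "mover (Suc n) = P \<longleftrightarrow> mover n \<noteq> P"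
  by (cases P) (auto simp: mover_def)

lemma token_Suc_in_children:
  assumes "strategy N s1" "strategy N s2" "children N (token s1 s2 n) \<noteq> {}"
  shows "token s1 s2 (Suc n) \<in> children N (token s1 s2 n)"
  using assms by (auto simp: strategy_def)

text \<open>A variable attacker \<open>P\<close> covers both seats. Each round lowers
  \<open>n\<close> by one and nothing is won or lost at \<open>n = 0\<close>, so the play ends in
  favour of \<open>P\<close> before the bound runs out.\<close>

lemma attack_wins:
  assumes s: "strategy N s1" "strategy N s2"
    and attack: "\<And>v n. wins (Suc n) N L v \<Longrightarrow>
      L ((if P = First then s1 else s2) v) = Target \<or>
      L ((if P = First then s1 else s2) v) = Safe \<and> loses n N L ((if P = First then s1 else s2) v)"
    and "\<And>m. m < k \<Longrightarrow> \<not> mover_wins_round N L s1 s2 m \<and> \<not> mover_loses_round N L s1 s2 m"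
    and "if mover k = P then wins n N L (token s1 s2 k) else loses n N L (token s1 s2 k)"
  shows "play_won_by P N L s1 s2"
  using assms(4,5)
proof (induction n arbitrary: k)
  case 0
  then show ?case by (simp split: if_splits)
next
  case (Suc n)
  note notyet = Suc.prems(1)
  let ?v = "token s1 s2 k" and ?w = "token s1 s2 (Suc k)"
  have finish: ?case
    if "mover k = P \<and> mover_wins_round N L s1 s2 k \<or> mover k \<noteq> P \<and> mover_loses_round N L s1 s2 k"
    using that notyet unfolding play_won_by_def by blast
  have continue: ?case
    if "children N ?v \<noteq> {}" "L ?w = Safe"
      "if mover (Suc k) = P then wins n N L ?w else loses n N L ?w"
  proof (rule Suc.IH[OF _ that(3)])
    fix m assume "m < Suc k"
    then show "\<not> mover_wins_round N L s1 s2 m \<and> \<not> mover_loses_round N L s1 s2 m"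
      using notyet that(1,2)
      by (cases "m = k") (auto simp: mover_wins_round_def mover_loses_round_def less_Suc_eq
          simp del: token.simps(2))
  qed
  show ?case
  proof (cases "mover k = P")
    case True
    then have "wins (Suc n) N L ?v"
      using Suc.prems(2) by simp
    moreover from this have "children N ?v \<noteq> {}" by auto
    moreover have "?w = (if P = First then s1 else s2) ?v"
      using True by simp
    ultimately show ?thesis
      using attack[of n ?v] finish continue True
      by (metis mover_Suc mover_wins_round_def)
  next
    case False
    then have lose: "loses (Suc n) N L ?v"
      using Suc.prems(2) by simp
    show ?thesis
    proof (cases "children N ?v = {}")
      case True
      then show ?thesis
        using finish False by (simp add: mover_loses_round_def)
    next
      case ne: False
      then have "L ?w = Trap \<or> L ?w = Safe \<and> wins n N L ?w"
        using token_Suc_in_children[OF s ne] lose by auto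
      then show ?thesis
        using finish continue False ne by (metis mover_Suc mover_loses_round_def)
    qed
  qed
qed

text \<open>Here the opponent of \<open>P\<close> defends. As long as the play lasts,
  \<open>P\<close> has no bounded win when to move, and the defender has no bounded loss when to
  move. Either way of ending in favour of \<open>P\<close> contradicts this.\<close>

lemma defence_avoids_loss:
  assumes s: "strategy N s1" "strategy N s2"
    and defend: "\<And>v. (\<And>n. \<not> loses n N L v) \<Longrightarrow>
      L ((if P = First then s2 else s1) v) = Target \<or>
      L ((if P = First then s2 else s1) v) = Safe \<and>
        (\<forall>n. \<not> wins n N L ((if P = First then s2 else s1) v))"
    and start: "if mover 0 = P then \<forall>n. \<not> wins n N L [] else \<forall>n. \<not> loses n N L []"
  shows "\<not> play_won_by P N L s1 s2"
proof
  let ?t = "token s1 s2"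
  assume "play_won_by P N L s1 s2"
  then obtain n where
    notyet: "\<And>m. m < n \<Longrightarrow> \<not> mover_wins_round N L s1 s2 m \<and> \<not> mover_loses_round N L s1 s2 m"
    and end_n: "mover n = P \<and> mover_wins_round N L s1 s2 n \<or>
      mover n \<noteq> P \<and> mover_loses_round N L s1 s2 n"
    unfolding play_won_by_def by blast
  have step: "?t (Suc m) = (if P = First then s2 else s1) (?t m)" if "mover m \<noteq> P" for m
    using that by (cases P) (auto simp: mover_def)
  have inv: "if mover m = P then \<forall>k. \<not> wins k N L (?t m) else \<forall>k. \<not> loses k N L (?t m)"
    if "m \<le> n" for m
    using that
  proof (induction m)
    case 0
    then show ?case using start by simp
  next
    case (Suc m)
    then have IH: "if mover m = P then \<forall>k. \<not> wins k N L (?t m) else \<forall>k. \<not> loses k N L (?t m)"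
      by simp
    have ne: "children N (?t m) \<noteq> {}" and "L (?t (Suc m)) \<noteq> Target" "L (?t (Suc m)) \<noteq> Trap"
      using notyet[of m] Suc.prems by (auto simp: mover_wins_round_def mover_loses_round_def)
    then have safe: "L (?t (Suc m)) = Safe"
      by (metis edge_label.exhaust)
    show ?case
    proof (cases "mover m = P")
      case True
      have "\<not> loses k N L (?t (Suc m))" for k
        using IH True safe token_Suc_in_children[OF s ne] by (metis wins.simps(2))
      then show ?thesis
        using True mover_Suc by metis
    next
      case False
      then have "\<forall>k. \<not> wins k N L (?t (Suc m))"
        using IH defend[of "?t m"] step[OF False] safe by (metis edge_label.distinct(5))
      then show ?thesis
        using False mover_Suc by metis
    qed
  qed
  from end_n show False
  proof
    assume *: "mover n = P \<and> mover_wins_round N L s1 s2 n"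
    then have "wins (Suc 0) N L (?t n)"
      using token_Suc_in_children[OF s, of n]
      by (auto simp: mover_wins_round_def simp del: token.simps(2))
    moreover have "\<forall>k. \<not> wins k N L (?t n)"
      using inv[of n] * by simp
    ultimately show False by blast
  next
    assume *: "mover n \<noteq> P \<and> mover_loses_round N L s1 s2 n"
    then have nl: "\<forall>k. \<not> loses k N L (?t n)"
      using inv[of n] by auto
    \<comment> \<open>A leaf would be a loss within one round, so the defender does not stand at
      one.\<close>
    from spec[OF this, of 1] have "children N (?t n) \<noteq> {}"
      by auto
    then have "L (?t (Suc n)) = Trap"
      using * unfolding mover_loses_round_def by blast
    then show False
      using nl defend[of "?t n"] step[of n] * by (metis edge_label.distinct(1,3))
  qed
qed

text \<open>If no bounded win exists, a single defending strategy refutes every \<open>s1\<close>.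
  So a forced win always comes with a uniform bound on the number of rounds.\<close>

lemma game_won_iff: "game_won N L \<longleftrightarrow> (\<exists>n. wins n N L [])"
proof
  assume "\<exists>n. wins n N L []"
  then obtain n where n: "wins n N L []" by blast
  obtain s where "strategy N s"
    "\<And>v n. wins (Suc n) N L v \<Longrightarrow> L (s v) = Target \<or> L (s v) = Safe \<and> loses n N L (s v)"
    using attacking_strategy_exists by metis
  then show "game_won N L"
    unfolding game_won_def using n
    by (intro exI[of _ s] conjI allI impI attack_wins[where P = First and k = 0 and n = n])
      (simp_all add: mover_def)
next
  assume "game_won N L"
  then obtain s1 where s1: "strategy N s1" "\<And>s2. strategy N s2 \<Longrightarrow> play_won_by First N L s1 s2"
    unfolding game_won_def by blast
  obtain s2 where s2: "strategy N s2" "\<And>v. (\<And>n. \<not> loses n N L v) \<Longrightarrow>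
      L (s2 v) = Target \<or> L (s2 v) = Safe \<and> (\<forall>n. \<not> wins n N L (s2 v))"
    using defending_strategy_exists by metis
  show "\<exists>n. wins n N L []"
  proof (rule ccontr)
    assume "\<nexists>n. wins n N L []"
    then have "\<not> play_won_by First N L s1 s2"
      using s1(1) s2 by (intro defence_avoids_loss) (simp_all add: mover_def)
    then show False using s1(2) s2(1) by blast
  qed
qed

lemma game_lost_iff: "game_lost N L \<longleftrightarrow> (\<exists>n. loses n N L [])"
proof
  assume "\<exists>n. loses n N L []"
  then obtain n where n: "loses n N L []" by blast
  obtain s where "strategy N s"
    "\<And>v n. wins (Suc n) N L v \<Longrightarrow> L (s v) = Target \<or> L (s v) = Safe \<and> loses n N L (s v)"
    using attacking_strategy_exists by metis
  then show "game_lost N L"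
    unfolding game_lost_def using n
    by (intro exI[of _ s] conjI allI impI attack_wins[where P = Second and k = 0 and n = n])
      (simp_all add: mover_def)
next
  assume "game_lost N L"
  then obtain s2 where s2: "strategy N s2" "\<And>s1. strategy N s1 \<Longrightarrow> play_won_by Second N L s1 s2"
    unfolding game_lost_def by blast
  obtain s1 where s1: "strategy N s1" "\<And>v. (\<And>n. \<not> loses n N L v) \<Longrightarrow>
      L (s1 v) = Target \<or> L (s1 v) = Safe \<and> (\<forall>n. \<not> wins n N L (s1 v))"
    using defending_strategy_exists by metis
  show "\<exists>n. loses n N L []"
  proof (rule ccontr)
    assume "\<nexists>n. loses n N L []"
    then have "\<not> play_won_by Second N L s1 s2"
      using s2(1) s1 by (intro defence_avoids_loss) (simp_all add: mover_def)
    then show False using s2(2) s1(1) by blast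
  qed
qed

section \<open>Passing to the subtree of a child\<close>

lemma children_Cons: "children N (i # v) = Cons i ` children (\<lambda>u. N (i # u)) v"
  by (auto simp: children_def)

text \<open>Dropping the leading \<open>i\<close> from addresses turns the game below child
  \<open>i\<close> into a game started at \<open>[]\<close>, so the recursion can be stated for the
  root alone.\<close>

lemma wins_loses_Cons:
  "wins n N L (i # v) = wins n (\<lambda>u. N (i # u)) (\<lambda>u. L (i # u)) v \<and>
   loses n N L (i # v) = loses n (\<lambda>u. N (i # u)) (\<lambda>u. L (i # u)) v"
  by (induction n arbitrary: v) (simp_all add: children_Cons)

lemma wins_Suc_root:
  "wins (Suc n) N L [] \<longleftrightarrow> (\<exists>i<N []. L [i] = Target \<or>
     L [i] = Safe \<and> loses n (\<lambda>u. N (i # u)) (\<lambda>u. L (i # u)) [])"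
  using wins_loses_Cons[of n N L _ "[]"] by (auto simp: children_def)

lemma loses_Suc_root:
  "loses (Suc n) N L [] \<longleftrightarrow> (\<forall>i<N []. L [i] = Trap \<or>
     L [i] = Safe \<and> wins n (\<lambda>u. N (i # u)) (\<lambda>u. L (i # u)) [])"
  using wins_loses_Cons[of n N L _ "[]"] by (auto simp: children_def)

subsection \<open>Two-cycles of the map \<open>y \<mapsto> c - b * y ^ d\<close>\<close>

text \<open>This is AM-GM for \<open>n\<close> copies of \<open>x ^ Suc n\<close> and one of
  \<open>m ^ Suc n\<close>. The induction step multiplies by \<open>x\<close> and adds a product of
  two differences of equal sign.\<close>

lemma weighted_power_mean_nonneg:
  fixes x m :: real
  assumes "x \<ge> 0" "m \<ge> 0"
  shows "real (Suc n) * m * x ^ n \<le> real n * x ^ Suc n + m ^ Suc n"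
proof (induction n)
  case (Suc n)
  have "(x ^ Suc n - m ^ Suc n) * (x - m) \<ge> 0"
    using assms by (cases "x \<ge> m")
      (auto intro!: mult_nonneg_nonneg mult_nonpos_nonpos power_mono simp del: power_Suc)
  moreover have "x * (real n * x ^ Suc n + m ^ Suc n) \<ge> x * (real (Suc n) * m * x ^ n)"
    using Suc assms by (intro mult_left_mono)
  ultimately show ?case
    by (simp add: algebra_simps)
qed simp

text \<open>Strictness comes from the last induction step alone, where the two differences are
  nonzero.\<close>

lemma weighted_power_mean_pos:
  fixes x m :: real
  assumes "x \<ge> 0" "m \<ge> 0" "x \<noteq> m" "n > 0"
  shows "real (Suc n) * m * x ^ n < real n * x ^ Suc n + m ^ Suc n"
proof -
  obtain k where n: "n = Suc k"
    using assms(4) gr0_conv_Suc by blast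
  have "(x ^ Suc k - m ^ Suc k) * (x - m) > 0"
  proof (cases "x > m")
    case True
    then show ?thesis
      using assms by (intro mult_pos_pos) (auto intro!: power_strict_mono simp del: power_Suc)
  next
    case False
    then show ?thesis
      using assms by (intro mult_neg_neg) (auto intro!: power_strict_mono simp del: power_Suc)
  qed
  moreover have "x * (real k * x ^ Suc k + m ^ Suc k) \<ge> x * (real (Suc k) * m * x ^ k)"
    using weighted_power_mean_nonneg assms by (intro mult_left_mono)
  ultimately show ?thesis
    unfolding n by (simp add: algebra_simps)
qed

text \<open>
  With \<open>m\<close> chosen such that \<open>b * d * m ^ (d - 1) = 1\<close>, the polynomial \<open>A\<close> below satisfies
  \<open>A v - A u = (v - u) / b * ((d - 1) / (d + 1) * c - m * (1 - 1 / d))\<close> for a 2-cycle \<open>{u, v}\<close>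
  of \<open>y \<mapsto> c - b * y ^ d\<close>; monotonicity of \<open>A\<close> therefore bounds \<open>c\<close> from below.
\<close>

lemma two_cycle_imp_threshold_less:
  fixes d :: nat and b c u v :: real
  assumes d: "d \<ge> 2" and b: "b > 0" and uv: "0 \<le> u" "u < v"
    and v: "v = c - b * u ^ d" and u: "u = c - b * v ^ d"
  shows "(real d + 1) ^ (d - 1) / real d ^ d < b * c ^ (d - 1)"
proof -
  obtain n where n: "d = Suc n" "n > 0"
    using d by (cases d) auto
  \<comment> \<open>The slope of \<open>y \<mapsto> c - b * y ^ d\<close> at \<open>m\<close> is
    -1.\<close>
  define m where "m = root n (1 / (b * real d))"
  have m: "m > 0"
    using b n unfolding m_def by simp
  have mn: "m ^ n = 1 / (b * real d)"
    using b n unfolding m_def by (simp add: real_root_pow_pos2)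
  \<comment> \<open>This value of \<open>a\<close> makes the derivative of \<open>A\<close> exactly
    the gap in the power mean inequality.\<close>
  define a where "a = real n / (real n + 2)"
  have a: "a * (real n + 2) = real n"
    by (simp add: a_def)
  define A where "A t = a * t ^ (n + 2) - m * t ^ Suc n + m ^ Suc n * t" for t :: real
  have A': "(A has_real_derivative real n * t ^ Suc n + m ^ Suc n - real (Suc n) * m * t ^ n) (at t)" for t
  proof -
    have "(A has_real_derivative
        a * (real (n + 2) * t ^ (n + 2 - 1)) - m * (real (Suc n) * t ^ (Suc n - 1)) + m ^ Suc n) (at t)"
      unfolding A_def by (auto intro!: derivative_eq_intros simp del: power_Suc)
    also have "a * (real (n + 2) * t ^ (n + 2 - 1)) = a * (real n + 2) * t ^ Suc n"
      by simp
    finally show ?thesis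
      unfolding a by (simp add: algebra_simps)
  qed
  have contA: "continuous_on S A" for S
    using A' DERIV_continuous continuous_at_imp_continuous_on by blast
  \<comment> \<open>On the nonnegative axis the derivative can vanish only at \<open>m\<close>, so
    \<open>A\<close> increases strictly on either side; an interval with \<open>m\<close> inside is
    split there.\<close>
  have inc: "A x < A y" if "0 \<le> x" "x < y" "\<not> (x < m \<and> m < y)" for x y
  proof (rule DERIV_pos_imp_increasing_open[OF that(2) _ contA])
    fix t assume "x < t" "t < y"
    then show "\<exists>l. (A has_real_derivative l) (at t) \<and> 0 < l"
      using A'[of t] weighted_power_mean_pos[of t m n] that m n(2)
      by (intro exI[of _ "real n * t ^ Suc n + m ^ Suc n - real (Suc n) * m * t ^ n"])
        (auto simp del: power_Suc of_nat_Suc)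
  qed
  have "A u < A v"
    using inc[of u v] inc[of u m] inc[of m v] uv m by (cases "u < m \<and> m < v") auto
  \<comment> \<open>The cycle equations make the powers of \<open>u\<close> and \<open>v\<close>
    linear, so that \<open>A v - A u\<close> acquires the factor \<open>v - u\<close>.\<close>
  have vv: "b * v ^ Suc n = c - u" and uu: "b * u ^ Suc n = c - v"
    using u v unfolding n(1) by linarith+
  have e1: "b * (v ^ Suc n - u ^ Suc n) = v - u"
    unfolding right_diff_distrib vv uu by simp
  have e2: "b * (v ^ (n + 2) - u ^ (n + 2)) = c * (v - u)"
  proof -
    have "b * (v ^ (n + 2) - u ^ (n + 2)) = v * (b * v ^ Suc n) - u * (b * u ^ Suc n)"
      by (simp add: algebra_simps)
    also have "\<dots> = c * (v - u)"
      unfolding vv uu by (simp add: algebra_simps)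
    finally show ?thesis .
  qed
  have e3: "b * m ^ Suc n = m / real d"
    using b mn by (simp add: field_simps)
  have "b * (A v - A u) = a * (b * (v ^ (n + 2) - u ^ (n + 2)))
      - m * (b * (v ^ Suc n - u ^ Suc n)) + (b * m ^ Suc n) * (v - u)"
    unfolding A_def by (simp only: algebra_simps)
  also have "\<dots> = (v - u) * (a * c - m * (1 - 1 / real d))"
    unfolding e1 e2 e3 by (simp add: algebra_simps)
  finally have "0 < (v - u) * (a * c - m * (1 - 1 / real d))"
    using \<open>A u < A v\<close> b by (metis diff_gt_0_iff_gt mult_pos_pos)
  then have "m * (1 - 1 / real d) < a * c"
    using uv by (simp add: zero_less_mult_iff)
  \<comment> \<open>The left side is the value of \<open>c\<close> for which \<open>m\<close> would
    be the fixed point, since \<open>b * m ^ d = m / d\<close>.\<close>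
  then have "m * (real d + 1) / real d < c"
  proof -
    assume "m * (1 - 1 / real d) < a * c"
    then have "real n * (m * (real n + 2)) < real n * (c * (real n + 1))"
      using n by (simp add: a_def field_simps)
    then have "m * (real n + 2) < c * (real n + 1)"
      using n(2) by (simp only: mult_less_cancel_left_pos of_nat_0_less_iff)
    then show ?thesis
      using n by (simp add: field_simps)
  qed
  then have "(m * (real d + 1) / real d) ^ n < c ^ n"
    using m n by (intro power_strict_mono) auto
  then have "b * (m * (real d + 1) / real d) ^ n < b * c ^ n"
    using b by simp
  moreover have "b * (m * (real d + 1) / real d) ^ n = (real d + 1) ^ (d - 1) / real d ^ d"
    using b n by (simp add: power_mult_distrib power_divide mn del: of_nat_Suc)
  ultimately show ?thesis
    using n by simp
qed

text \<open>Above the threshold \<open>F\<close> has slope below -1 at a fixed point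
  \<open>y\<close>, so \<open>F (F t) < t\<close> just left of \<open>y\<close>, whereas
  \<open>F (F lo) \<ge> lo\<close>. Between these points \<open>F \<circ> F\<close> has a fixed
  point, which lies below \<open>y\<close>.\<close>

lemma two_cycle_exists:
  fixes d :: nat and b c lo hi :: real
  defines "F \<equiv> \<lambda>y. c - b * y ^ d"
  assumes d: "d \<ge> 2" and b: "b > 0" and lo: "0 \<le> lo" "lo \<le> hi"
    and ivl: "lo < F lo" "F lo \<le> hi" "lo \<le> F hi"
    and thr: "(real d + 1) ^ (d - 1) / real d ^ d < b * c ^ (d - 1)"
  shows "\<exists>u v. lo \<le> u \<and> u < v \<and> v \<le> hi \<and> v = F u \<and> u = F v"
proof -
  have anti: "F y \<le> F x" if "0 \<le> x" "x \<le> y" for x y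
    using that b unfolding F_def by (simp add: power_mono)
  have F_ivl: "lo \<le> F x" "F x \<le> hi" if "lo \<le> x" "x \<le> hi" for x
    using anti[of lo x] anti[of x hi] that lo ivl by auto
  have "\<exists>y. lo \<le> y \<and> y \<le> hi \<and> y - F y = 0"
  proof (rule IVT')
    show "continuous_on {lo..hi} (\<lambda>y. y - F y)"
      unfolding F_def by (intro continuous_intros)
  qed (use ivl F_ivl[of hi] lo in auto)
  then obtain y where y: "lo \<le> y" "y \<le> hi" "F y = y" by auto
  have "lo < y" using y ivl by (metis order_le_less less_irrefl)
  \<comment> \<open>With \<open>z = b * y ^ (d - 1)\<close> the fixed point equation reads
    \<open>c = y * (1 + z)\<close>. Hence \<open>b * c ^ (d - 1) = z * (1 + z) ^ (d - 1)\<close>,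
    which is increasing in \<open>z\<close> and equals the threshold at
    \<open>z = 1 / d\<close>.\<close>
  have steep: "1 < b * d * y ^ (d - 1)"
  proof (rule ccontr)
    define z where "z = b * y ^ (d - 1)"
    assume "\<not> ?thesis"
    then have z: "0 \<le> z" "z \<le> 1 / real d"
      using d b lo y unfolding z_def by (auto simp: field_simps)
    have "c = y * (1 + z)"
      using y(3) d unfolding F_def z_def by (cases d) (auto simp: algebra_simps)
    then have "b * c ^ (d - 1) = z * (1 + z) ^ (d - 1)"
      by (simp add: z_def power_mult_distrib)
    also have "\<dots> \<le> 1 / real d * (1 + 1 / real d) ^ (d - 1)"
      using z by (intro mult_mono power_mono) auto
    also have "1 + 1 / real d = (real d + 1) / real d"
      using d by (simp add: field_simps)
    also have "1 / real d * ((real d + 1) / real d) ^ (d - 1) = (real d + 1) ^ (d - 1) / real d ^ d"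
      using d by (cases d) (auto simp: power_divide)
    finally show False using thr by simp
  qed
  define G where "G t = F (F t) - t" for t
  have F': "(F has_real_derivative - (b * d * t ^ (d - 1))) (at t)" for t
    unfolding F_def by (auto intro!: derivative_eq_intros)
  have "((\<lambda>t. F (F t)) has_real_derivative (- (b * d * y ^ (d - 1))) * (- (b * d * y ^ (d - 1)))) (at y)"
    using DERIV_chain2[of F _ F y] F'[of y] F'[of "F y"] y(3) by metis
  then have G': "(G has_real_derivative (b * d * y ^ (d - 1)) * (b * d * y ^ (d - 1)) - 1) (at y)"
    unfolding G_def by (auto intro!: derivative_eq_intros)
  have "(b * d * y ^ (d - 1)) * (b * d * y ^ (d - 1)) - 1 > 0"
    using less_1_mult[OF steep steep] by simp
  then obtain e where e: "e > 0" "\<And>h. h > 0 \<Longrightarrow> h < e \<Longrightarrow> G (y - h) < G y"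
    using DERIV_pos_inc_left[OF G'] by blast
  define h where "h = min (e / 2) (y - lo)"
  have h: "h > 0" "h < e" "lo \<le> y - h"
    using e \<open>lo < y\<close> unfolding h_def by auto
  have "G (y - h) < 0" using e(2)[OF h(1,2)] y by (simp add: G_def)
  moreover have "G lo \<ge> 0"
    using F_ivl[of "F lo"] ivl by (simp add: G_def)
  ultimately have "\<exists>u. lo \<le> u \<and> u \<le> y - h \<and> G u = 0"
  proof (intro IVT2')
    show "continuous_on {lo..y - h} G"
      unfolding F_def G_def by (intro continuous_intros)
  qed (use h in auto)
  then obtain u where u: "lo \<le> u" "u \<le> y - h" "G u = 0" by blast
  \<comment> \<open>This gives \<open>u < y \<le> F u\<close>, so the cycle is genuine and not a
    fixed point of \<open>F\<close>.\<close>
  have "y \<le> F u"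
    using anti[of u y] u h lo y(3) by simp
  then show ?thesis
    using u h y F_ivl[of u] by (intro exI[of _ u] exI[of _ "F u"]) (simp add: G_def)
qed

text \<open>The limits satisfy \<open>S = F T\<close> and \<open>T = F S\<close>, so they form a
  2-cycle unless they agree. Conversely, a 2-cycle in the starting interval stays between
  \<open>t n\<close> and \<open>s n\<close> and keeps the limits apart.\<close>

lemma alternating_iteration_limits_eq_iff:
  fixes d :: nat and b c :: real and s t :: "nat \<Rightarrow> real"
  defines "F \<equiv> \<lambda>y. c - b * y ^ d"
  assumes d: "d \<ge> 2" and b: "b > 0" and start: "0 \<le> t 0" "t 0 \<le> s 0"
    and ivl: "t 0 < F (t 0)" "F (t 0) \<le> s 0" "t 0 \<le> F (s 0)"
    and rec: "\<And>n. s (Suc n) = F (t n)" "\<And>n. t (Suc n) = F (s n)"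
    and lim: "s \<longlonglongrightarrow> S" "t \<longlonglongrightarrow> T"
  shows "S = T \<longleftrightarrow> b * c ^ (d - 1) \<le> (real d + 1) ^ (d - 1) / real d ^ d"
proof -
  have anti: "F y \<le> F x" if "0 \<le> x" "x \<le> y" for x y
    using that b unfolding F_def by (simp add: power_mono)
  have "t 0 \<le> t n \<and> t n \<le> s n \<and> s n \<le> s 0" for n
  proof (induction n)
    case (Suc n)
    then show ?case
      using anti[of "t 0" "t n"] anti[of "t n" "s n"] anti[of "s n" "s 0"] start ivl
      by (simp add: rec)
  qed (use start in simp)
  note bounds = this
  have "0 \<le> t n" for n
    using bounds[of n] start by linarith
  then have T0: "0 \<le> T"
    by (intro LIMSEQ_le_const[OF lim(2)]) blast
  have "T \<le> S"
    using bounds by (intro LIMSEQ_le[OF lim(2,1)]) blast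
  have F_lim: "(\<lambda>n. F (x n)) \<longlonglongrightarrow> F X" if "x \<longlonglongrightarrow> X" for x X
    unfolding F_def by (intro tendsto_intros that)
  have "S = F T"
    using LIMSEQ_unique[OF LIMSEQ_Suc[OF lim(1), unfolded rec] F_lim[OF lim(2)]] .
  have "T = F S"
    using LIMSEQ_unique[OF LIMSEQ_Suc[OF lim(2), unfolded rec] F_lim[OF lim(1)]] .
  show ?thesis
  proof
    assume thr: "b * c ^ (d - 1) \<le> (real d + 1) ^ (d - 1) / real d ^ d"
    show "S = T"
    proof (rule ccontr)
      assume "S \<noteq> T"
      then show False
        using two_cycle_imp_threshold_less[OF d b, of T S c] T0 \<open>T \<le> S\<close> \<open>S \<noteq> T\<close>
          \<open>S = F T\<close> \<open>T = F S\<close> thr unfolding F_def by linarith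
    qed
  next
    assume eq: "S = T"
    show "b * c ^ (d - 1) \<le> (real d + 1) ^ (d - 1) / real d ^ d"
    proof (rule ccontr)
      assume "\<not> ?thesis"
      then obtain u v where uv: "t 0 \<le> u" "u < v" "v \<le> s 0" "F u = v" "F v = u"
        using two_cycle_exists[OF d b start, of c] ivl unfolding F_def not_le by metis
      \<comment> \<open>Since \<open>F\<close> is antitone and swaps \<open>u\<close> and
        \<open>v\<close>, the bound on \<open>t n\<close> yields the next one on \<open>s\<close>,
        and vice versa.\<close>
      have "t 0 \<le> t n \<and> t n \<le> u \<and> v \<le> s n \<and> s n \<le> s 0" for n
      proof (induction n)
        case (Suc n)
        then show ?case
          using anti[of "t 0" "t n"] anti[of "t n" u] anti[of v "s n"] anti[of "s n" "s 0"]
            start ivl uv by (simp add: rec)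
      qed (use uv in simp)
      then have "T \<le> u" "v \<le> S"
        using LIMSEQ_le_const2[OF lim(2)] LIMSEQ_le_const[OF lim(1)] by blast+
      then show False using uv eq by simp
    qed
  qed
qed

subsection \<open>Independence of the root and the subtrees of its children\<close>

text \<open>The joint law of the coordinates is the product measure itself, that is, the product of
  their marginals.\<close>

lemma indep_vars_PiM_components:
  assumes "\<And>i. i \<in> I \<Longrightarrow> prob_space (M i)" "I \<noteq> {}"
  shows "prob_space.indep_vars (PiM I M) M (\<lambda>i \<omega>. \<omega> i) I"
proof -
  interpret prob_space "PiM I M"
    using assms(1) by (rule prob_space_PiM)
  have "distr (PiM I M) (PiM I M) (\<lambda>x. \<lambda>i\<in>I. x i) = distr (PiM I M) (PiM I M) (\<lambda>x. x)"
    by (intro distr_cong) (auto simp: space_PiM PiE_restrict)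
  also have "\<dots> = (\<Pi>\<^sub>M i\<in>I. distr (PiM I M) (M i) (\<lambda>x. x i))"
    unfolding distr_id2[OF refl] using assms(1) by (intro PiM_cong) (simp_all add: distr_PiM_component)
  finally show ?thesis
    using assms(2) by (subst indep_vars_iff_distr_eq_PiM') simp_all
qed

lemma shift_measurable: "(\<lambda>f v. f (i # v)) \<in> measurable (\<Pi>\<^sub>M v\<in>UNIV. M) (\<Pi>\<^sub>M v\<in>UNIV. M)"
  by (intro measurable_PiM_single') (auto simp: space_PiM PiE_iff)

text \<open>The root and the sets of addresses beginning with a given \<open>i\<close> are disjoint
  blocks of coordinates, hence independent. As \<open>(#) i\<close> is injective, each block of the
  latter kind is a copy of the whole product.\<close>

lemma nn_integral_root_children:
  fixes M :: "'a measure" and h :: "'a \<Rightarrow> ennreal" and \<phi> :: "nat \<Rightarrow> (nat list \<Rightarrow> 'a) \<Rightarrow> ennreal"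
  assumes "prob_space M"
    and h[measurable]: "h \<in> borel_measurable M"
    and \<phi>: "\<And>i. \<phi> i \<in> borel_measurable (\<Pi>\<^sub>M v\<in>UNIV. M)"
  shows "(\<integral>\<^sup>+f. h (f []) * (\<Prod>i<k. \<phi> i (\<lambda>v. f (i # v))) \<partial>(\<Pi>\<^sub>M v\<in>UNIV. M)) =
    (\<integral>\<^sup>+x. h x \<partial>M) * (\<Prod>i<k. \<integral>\<^sup>+f. \<phi> i f \<partial>(\<Pi>\<^sub>M v\<in>UNIV. M))"
proof -
  let ?P = "\<Pi>\<^sub>M v\<in>(UNIV :: nat list set). M"
  interpret prob_space ?P
    using assms(1) by (intro prob_space_PiM)
  \<comment> \<open>Block 0 is the root, block \<open>Suc i\<close> the subtree of child
    \<open>i\<close>.\<close>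
  define K :: "nat \<Rightarrow> nat list set" where "K = case_nat {[]} (\<lambda>i. range ((#) i))"
  define Y where "Y = case_nat (\<lambda>g. h (g [])) (\<lambda>i g. \<phi> i (\<lambda>v. g (i # v)))"
  have "indep_vars (\<lambda>_. M) (\<lambda>v f. f v) (UNIV :: nat list set)"
    using assms(1) by (intro indep_vars_PiM_components) auto
  then have "indep_vars (\<lambda>j. PiM (K j) (\<lambda>_. M)) (\<lambda>j f. restrict f (K j)) {..k}"
    by (rule indep_vars_restrict) (auto simp: disjoint_family_on_def K_def split: nat.splits)
  then have "indep_vars (\<lambda>_. borel) (\<lambda>j f. Y j (restrict f (K j))) {..k}"
  proof (rule indep_vars_compose2)
    fix j
    show "Y j \<in> borel_measurable (PiM (K j) (\<lambda>_. M))"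
    proof (cases j)
      case 0
      then show ?thesis
        unfolding Y_def K_def
        by (auto intro!: measurable_compose[OF measurable_component_singleton[of "[]" "{[]}" "\<lambda>_. M"] h])
    next
      case (Suc i)
      have "(\<lambda>g v. g (i # v)) \<in> measurable (PiM (range ((#) i)) (\<lambda>_. M)) ?P"
        by (intro measurable_PiM_single') (auto simp: space_PiM PiE_iff)
      then show ?thesis
        using Suc unfolding Y_def K_def by (auto intro: measurable_compose[OF _ \<phi>])
    qed
  qed
  then have "(\<integral>\<^sup>+f. (\<Prod>j\<le>k. Y j (restrict f (K j))) \<partial>?P) = (\<Prod>j\<le>k. \<integral>\<^sup>+f. Y j (restrict f (K j)) \<partial>?P)"
    by (intro indep_vars_nn_integral) auto
  moreover have "(\<integral>\<^sup>+f. Y 0 (restrict f (K 0)) \<partial>?P) = (\<integral>\<^sup>+x. h x \<partial>M)"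
  proof -
    have "(\<integral>\<^sup>+f. Y 0 (restrict f (K 0)) \<partial>?P) = (\<integral>\<^sup>+x. h x \<partial>distr ?P M (\<lambda>f. f []))"
      by (subst nn_integral_distr) (simp_all add: Y_def K_def)
    also have "distr ?P M (\<lambda>f. f []) = M"
      using assms(1) by (intro distr_PiM_component) auto
    finally show ?thesis .
  qed
  moreover have "(\<integral>\<^sup>+f. Y (Suc i) (restrict f (K (Suc i))) \<partial>?P) = (\<integral>\<^sup>+f. \<phi> i f \<partial>?P)" for i
  proof -
    have "(\<integral>\<^sup>+f. Y (Suc i) (restrict f (K (Suc i))) \<partial>?P) =
        (\<integral>\<^sup>+f. \<phi> i f \<partial>distr ?P ?P (\<lambda>f. \<lambda>v\<in>UNIV. f (i # v)))"
      using \<phi>[of i] by (subst nn_integral_distr) (simp_all add: Y_def K_def shift_measurable restrict_def)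
    also have "distr ?P ?P (\<lambda>f. \<lambda>v\<in>UNIV. f (i # v)) = ?P"
      using distr_PiM_reindex[of UNIV "\<lambda>_. M" "(#) i" UNIV] assms(1) by simp
    finally show ?thesis .
  qed
  ultimately have "(\<integral>\<^sup>+f. Y 0 (restrict f (K 0)) * (\<Prod>i<k. Y (Suc i) (restrict f (K (Suc i)))) \<partial>?P) =
      (\<integral>\<^sup>+x. h x \<partial>M) * (\<Prod>i<k. \<integral>\<^sup>+f. \<phi> i f \<partial>?P)"
    by (simp only: prod.atMost_shift)
  then show ?thesis
    by (simp add: Y_def K_def)
qed

section \<open>Measurability and factorization on the game space\<close>

locale percolation_space =
  fixes offspring :: "nat pmf" and p q :: real
begin

abbreviation (input) "G \<equiv> game_space offspring p q"

sublocale prob_space G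
  unfolding game_space_def
  by (intro prob_space_pair prob_space_PiM) (simp_all add: measure_pmf.prob_space_axioms)

lemma space_game_space: "space G = UNIV"
  by (auto simp: game_space_def space_pair_measure space_PiM)

lemma measurable_fst_component[measurable]: "(\<lambda>x. fst x v) \<in> measurable G (count_space UNIV)"
  unfolding game_space_def by measurable

lemma measurable_snd_component[measurable]: "(\<lambda>x. snd x v) \<in> measurable G (count_space UNIV)"
  unfolding game_space_def by measurable

lemma measurable_wins_loses:
  "Measurable.pred G (\<lambda>x. wins n (fst x) (snd x) v) \<and> Measurable.pred G (\<lambda>x. loses n (fst x) (snd x) v)"
proof (induction n arbitrary: v)
  case (Suc n)
  then have [measurable]: "Measurable.pred G (\<lambda>x. wins n (fst x) (snd x) w)"
      "Measurable.pred G (\<lambda>x. loses n (fst x) (snd x) w)" for w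
    by auto
  have "wins (Suc n) (fst x) (snd x) v \<longleftrightarrow> (\<exists>i. i < fst x v \<and> (snd x (v @ [i]) = Target \<or>
      snd x (v @ [i]) = Safe \<and> loses n (fst x) (snd x) (v @ [i])))" for x
    by (auto simp: children_def)
  moreover have "loses (Suc n) (fst x) (snd x) v \<longleftrightarrow> (\<forall>i. i < fst x v \<longrightarrow> (snd x (v @ [i]) = Trap \<or>
      snd x (v @ [i]) = Safe \<and> wins n (fst x) (snd x) (v @ [i])))" for x
    by (auto simp: children_def)
  ultimately show ?case
    by (simp del: wins.simps loses.simps)
qed simp

lemma pred_root[measurable]:
  "Measurable.pred G (\<lambda>x. fst x v \<in> Q)" "Measurable.pred G (\<lambda>x. snd x v \<in> R)"
  by (rule pred_sets2[OF _ measurable_fst_component] pred_sets2[OF _ measurable_snd_component], simp)+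

lemma pred_shift:
  assumes "T \<in> sets G"
  shows "Measurable.pred G (\<lambda>x. ((\<lambda>v. fst x (i # v)), (\<lambda>v. snd x (i # v))) \<in> T)"
proof (rule pred_sets2[OF assms])
  show "(\<lambda>x. ((\<lambda>v. fst x (i # v)), (\<lambda>v. snd x (i # v)))) \<in> measurable G G"
    unfolding game_space_def
    by (intro measurable_Pair measurable_compose[OF measurable_fst shift_measurable]
        measurable_compose[OF measurable_snd shift_measurable])
qed

text \<open>After the shift to child \<open>i\<close>, the address \<open>[]\<close> carries the
  label of the edge leading to that child, so \<open>T\<close> can test this label together with the
  subtree.\<close>

lemma emeasure_root_children:
  assumes T: "T \<in> sets G"
  shows "emeasure G {x. fst x [] \<in> Q \<and> snd x [] \<in> R \<and>
      (\<forall>i<k. ((\<lambda>v. fst x (i # v)), (\<lambda>v. snd x (i # v))) \<in> T)} =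
    emeasure (measure_pmf offspring) Q * emeasure (measure_pmf (label_pmf p q)) R * emeasure G T ^ k"
    (is "emeasure G ?E = _")
proof -
  let ?A = "\<Pi>\<^sub>M v\<in>(UNIV :: vertex set). measure_pmf offspring"
  let ?B = "\<Pi>\<^sub>M v\<in>(UNIV :: vertex set). measure_pmf (label_pmf p q)"
  interpret B: prob_space ?B
    by (intro prob_space_PiM) (simp add: measure_pmf.prob_space_axioms)
  have G: "G = ?A \<Otimes>\<^sub>M ?B" by (simp add: game_space_def)
  have T'[measurable]: "T \<in> sets (?A \<Otimes>\<^sub>M ?B)" using T G by simp
  \<comment> \<open>This is the probability of \<open>T\<close> given the offspring numbers. Fubini
    allows factorizing first over labels with \<open>N\<close> fixed, where the event varies with
    the child, and then over \<open>N\<close>.\<close>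
  define \<phi> where "\<phi> N = (\<integral>\<^sup>+L. indicator T (N, L) \<partial>?B)" for N
  have \<phi>: "\<phi> \<in> borel_measurable ?A"
    unfolding \<phi>_def by measurable
  have ind: "indicator ?E (N, L) = indicator Q (N []) *
      (indicator R (L []) * (\<Prod>i<k. indicator T ((\<lambda>v. N (i # v)), (\<lambda>v. L (i # v)))) :: ennreal)" for N L
    by (auto simp: indicator_def prod_zero_iff split: if_splits)
  have E: "?E \<in> sets (?A \<Otimes>\<^sub>M ?B)"
  proof -
    have [measurable]: "Measurable.pred G (\<lambda>x. ((\<lambda>v. fst x (i # v)), (\<lambda>v. snd x (i # v))) \<in> T)" for i
      using T by (rule pred_shift)
    have "Measurable.pred G (\<lambda>x. fst x [] \<in> Q \<and> snd x [] \<in> R \<and>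
        (\<forall>i<k. ((\<lambda>v. fst x (i # v)), (\<lambda>v. snd x (i # v))) \<in> T))"
      by measurable
    then have "?E \<in> sets G"
      by (simp add: pred_def space_game_space)
    then show ?thesis
      unfolding G .
  qed
  have "emeasure G ?E = (\<integral>\<^sup>+N. \<integral>\<^sup>+L. indicator ?E (N, L) \<partial>?B \<partial>?A)"
    unfolding G using E by (rule B.emeasure_pair_measure)
  also have "\<dots> = (\<integral>\<^sup>+N. indicator Q (N []) *
      (\<integral>\<^sup>+L. indicator R (L []) * (\<Prod>i<k. indicator T ((\<lambda>v. N (i # v)), (\<lambda>v. L (i # v)))) \<partial>?B) \<partial>?A)"
    unfolding ind by (intro nn_integral_cong) (simp add: indicator_def)
  also have "\<dots> = (\<integral>\<^sup>+N. emeasure (label_pmf p q) R * (indicator Q (N []) * (\<Prod>i<k. \<phi> (\<lambda>v. N (i # v)))) \<partial>?A)"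
  proof (intro nn_integral_cong)
    fix N
    have "(\<lambda>L. indicator T ((\<lambda>v. N (i # v)), L) :: ennreal) \<in> borel_measurable ?B" for i
      by (rule measurable_compose[OF measurable_Pair1'[of _ ?A]])
        (auto simp: space_PiM intro: borel_measurable_indicator)
    then show "indicator Q (N []) *
        (\<integral>\<^sup>+L. indicator R (L []) * (\<Prod>i<k. indicator T ((\<lambda>v. N (i # v)), (\<lambda>v. L (i # v)))) \<partial>?B) =
        emeasure (label_pmf p q) R * (indicator Q (N []) * (\<Prod>i<k. \<phi> (\<lambda>v. N (i # v))))"
      by (subst nn_integral_root_children[where \<phi> = "\<lambda>i L. indicator T ((\<lambda>v. N (i # v)), L)"])
        (simp_all add: measure_pmf.prob_space_axioms \<phi>_def mult_ac)
  qed
  also have "\<dots> = emeasure (label_pmf p q) R * (\<integral>\<^sup>+N. indicator Q (N []) * (\<Prod>i<k. \<phi> (\<lambda>v. N (i # v))) \<partial>?A)"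
  proof (rule nn_integral_cmult)
    have [measurable]: "(\<lambda>N. \<phi> (\<lambda>v. N (i # v))) \<in> borel_measurable ?A" for i
      by (rule measurable_compose[OF shift_measurable \<phi>])
    show "(\<lambda>N. indicator Q (N []) * (\<Prod>i<k. \<phi> (\<lambda>v. N (i # v)))) \<in> borel_measurable ?A"
      by measurable
  qed
  also have "\<dots> = emeasure (label_pmf p q) R * (emeasure offspring Q * (\<integral>\<^sup>+N. \<phi> N \<partial>?A) ^ k)"
    using \<phi> by (subst nn_integral_root_children[where \<phi> = "\<lambda>_. \<phi>"]) (simp_all add: measure_pmf.prob_space_axioms)
  also have "(\<integral>\<^sup>+N. \<phi> N \<partial>?A) = emeasure G T"
    unfolding G \<phi>_def using T' by (rule B.emeasure_pair_measure[symmetric])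
  finally show ?thesis by (simp add: mult_ac)
qed

lemma measure_root_children:
  assumes T: "T \<in> sets G"
  shows "measure G {x. fst x [] \<in> Q \<and> snd x [] \<in> R \<and>
      (\<forall>i<k. ((\<lambda>v. fst x (i # v)), (\<lambda>v. snd x (i # v))) \<in> T)} =
    measure (measure_pmf offspring) Q * measure (measure_pmf (label_pmf p q)) R * measure G T ^ k"
proof -
  show ?thesis
    using emeasure_root_children[OF T, of Q R k]
    by (simp add: emeasure_eq_measure measure_pmf.emeasure_eq_measure ennreal_power
        flip: ennreal_mult'')
qed

lemma measure_root_label: "measure G {x. snd x [] \<in> R} = measure (measure_pmf (label_pmf p q)) R"
  using measure_root_children[of "{}" UNIV R 0] by simp

lemma wins_measurable[measurable]: "Measurable.pred G (\<lambda>x. wins n (fst x) (snd x) v)"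
  and loses_measurable[measurable]: "Measurable.pred G (\<lambda>x. loses n (fst x) (snd x) v)"
  using measurable_wins_loses by auto

end

section \<open>Recursion for the win and loss probabilities\<close>

locale percolation_game = percolation_space +
  fixes d :: nat and \<pi> :: real
  assumes d: "d > 0"
    and pmf_offspring: "pmf offspring 0 = 1 - \<pi>" "pmf offspring d = \<pi>"
    and pq: "0 \<le> p" "0 \<le> q" "p + q \<le> 1"
begin

abbreviation "win_prob n \<equiv> prob {x. wins n (fst x) (snd x) []}"
abbreviation "loss_prob n \<equiv> prob {x. loses n (fst x) (snd x) []}"

lemma pred_sets_UNIV: "Measurable.pred G P \<Longrightarrow> {x. P x} \<in> events"
  by (simp add: pred_def space_game_space)

lemma prob_not: "{x. P x} \<in> events \<Longrightarrow> prob {x. \<not> P x} = 1 - prob {x. P x}"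
  using prob_neg[of P] by (simp add: space_game_space)

text \<open>Almost surely the root has 0 or \<open>d\<close> children. The first case satisfies the
  condition on children vacuously, the second needs \<open>d\<close> independent copies of
  \<open>T\<close>.\<close>

lemma prob_root_all_children:
  assumes T: "T \<in> events"
  shows "prob {x. snd x [] \<in> R \<and> (\<forall>i<fst x []. ((\<lambda>v. fst x (i # v)), (\<lambda>v. snd x (i # v))) \<in> T)} =
    measure (measure_pmf (label_pmf p q)) R * (1 - \<pi> + \<pi> * prob T ^ d)"
proof -
  let ?B = "\<lambda>k. {x. fst x [] \<in> {k} \<and> snd x [] \<in> R \<and>
      (\<forall>i<k. ((\<lambda>v. fst x (i # v)), (\<lambda>v. snd x (i # v))) \<in> T)}"
  have [measurable]: "Measurable.pred G (\<lambda>x. ((\<lambda>v. fst x (i # v)), (\<lambda>v. snd x (i # v))) \<in> T)" for i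
    using T by (rule pred_shift)
  have B: "?B k \<in> events" for k
    by (rule pred_sets_UNIV) measurable
  have "Measurable.pred G (\<lambda>x. snd x [] \<in> R \<and>
      (\<forall>i. i < fst x [] \<longrightarrow> ((\<lambda>v. fst x (i # v)), (\<lambda>v. snd x (i # v))) \<in> T))"
    by measurable
  then have A: "{x. snd x [] \<in> R \<and> (\<forall>i<fst x []. ((\<lambda>v. fst x (i # v)), (\<lambda>v. snd x (i # v))) \<in> T)} \<in> events"
    by (rule pred_sets_UNIV)
  have two: "measure (measure_pmf offspring) {0, d} = 1"
    using d pmf_offspring by (subst measure_measure_pmf_finite) auto
  have "prob {x. fst x [] \<in> {0, d}} = 1"
    using measure_root_children[of "{}" "{0, d}" UNIV 0] two by simp
  moreover have "{x. fst x [] \<in> {0, d}} \<in> events"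
    by (rule pred_sets_UNIV) measurable
  ultimately have "AE x in G. fst x [] \<in> {0, d}"
    using AE_in_set_eq_1 by fastforce
  then have "prob {x. snd x [] \<in> R \<and> (\<forall>i<fst x []. ((\<lambda>v. fst x (i # v)), (\<lambda>v. snd x (i # v))) \<in> T)} =
      prob (?B 0 \<union> ?B d)"
    using A sets.Un[OF B[of 0] B[of d]] by (intro finite_measure_eq_AE) auto
  also have "\<dots> = prob (?B 0) + prob (?B d)"
    using d by (intro finite_measure_Union[OF B B]) auto
  also have "\<dots> = measure (measure_pmf (label_pmf p q)) R * (1 - \<pi> + \<pi> * prob T ^ d)"
    unfolding measure_root_children[OF T] by (simp add: measure_pmf_single pmf_offspring algebra_simps)
  finally show ?thesis .
qed

lemma label_probs:
  "measure (measure_pmf (label_pmf p q)) {Trap} = p"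
  "measure (measure_pmf (label_pmf p q)) {Target} = q"
  "measure (measure_pmf (label_pmf p q)) {Safe} = 1 - p - q"
  using pq by (simp_all add: measure_pmf_single pmf_label_pmf)

lemma prob_label_loses_Suc:
  "prob {x. snd x [] \<in> R \<and> loses (Suc n) (fst x) (snd x) []} =
    measure (measure_pmf (label_pmf p q)) R *
      (1 - \<pi> + \<pi> * prob {x. snd x [] = Trap \<or> snd x [] = Safe \<and> wins n (fst x) (snd x) []} ^ d)"
proof -
  have "{x. snd x [] = Trap \<or> snd x [] = Safe \<and> wins n (fst x) (snd x) []} \<in> events"
    by (rule pred_sets_UNIV) measurable
  from prob_root_all_children[OF this] show ?thesis
    unfolding loses_Suc_root by simp
qed

text \<open>A win needs just one good child, so its complement has the form quantified over all
  children.\<close>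

lemma prob_label_not_wins_Suc:
  "prob {x. snd x [] \<in> R \<and> \<not> wins (Suc n) (fst x) (snd x) []} =
    measure (measure_pmf (label_pmf p q)) R *
      (1 - \<pi> + \<pi> * prob {x. \<not> (snd x [] = Target \<or> snd x [] = Safe \<and> loses n (fst x) (snd x) [])} ^ d)"
proof -
  have "{x. \<not> (snd x [] = Target \<or> snd x [] = Safe \<and> loses n (fst x) (snd x) [])} \<in> events"
    by (rule pred_sets_UNIV) measurable
  from prob_root_all_children[OF this] show ?thesis
    unfolding wins_Suc_root by simp
qed

text \<open>The label at \<open>[]\<close> is independent of the outcome below it: comparing
  \<open>R\<close> with \<open>UNIV\<close> in the one-step formula isolates the factor for the
  label.\<close>

lemma prob_label_loses:
  "prob {x. snd x [] \<in> R \<and> loses n (fst x) (snd x) []} =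
    measure (measure_pmf (label_pmf p q)) R * loss_prob n"
proof (cases n)
  case (Suc m)
  then show ?thesis
    using prob_label_loses_Suc[of R m] prob_label_loses_Suc[of UNIV m] by simp
qed simp

lemma prob_label_wins:
  "prob {x. snd x [] \<in> R \<and> wins n (fst x) (snd x) []} =
    measure (measure_pmf (label_pmf p q)) R * win_prob n"
proof (cases n)
  case (Suc m)
  have split: "prob {x. snd x [] \<in> R} = prob {x. snd x [] \<in> R \<and> wins n (fst x) (snd x) []} +
      prob {x. snd x [] \<in> R \<and> \<not> wins n (fst x) (snd x) []}" for R
  proof -
    have "{x. snd x [] \<in> R} = {x. snd x [] \<in> R \<and> wins n (fst x) (snd x) []} \<union>
        {x. snd x [] \<in> R \<and> \<not> wins n (fst x) (snd x) []}"
      by auto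
    moreover have "{x. snd x [] \<in> R \<and> wins n (fst x) (snd x) []} \<in> events"
      "{x. snd x [] \<in> R \<and> \<not> wins n (fst x) (snd x) []} \<in> events"
      by (rule pred_sets_UNIV, measurable)+
    ultimately show ?thesis
      by (metis (no_types, lifting) finite_measure_Union disjoint_iff mem_Collect_eq)
  qed
  define Y where "Y = prob {x. \<not> wins n (fst x) (snd x) []}"
  have "prob {x. snd x [] \<in> R \<and> \<not> wins n (fst x) (snd x) []} =
      measure (measure_pmf (label_pmf p q)) R * Y"
    using prob_label_not_wins_Suc[of R m] prob_label_not_wins_Suc[of UNIV m]
    by (simp add: Suc Y_def del: wins.simps)
  moreover have "win_prob n = 1 - Y"
    using split[of UNIV] prob_space by (simp add: Y_def space_game_space)
  ultimately show ?thesis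
    using split[of R] by (simp add: measure_root_label right_diff_distrib)
qed simp

lemma loss_prob_Suc: "loss_prob (Suc n) = 1 - \<pi> + \<pi> * (p + (1 - p - q) * win_prob n) ^ d"
proof -
  let ?W = "{x. snd x [] \<in> {Safe} \<and> wins n (fst x) (snd x) []}"
  have "prob {x. snd x [] = Trap \<or> snd x [] = Safe \<and> wins n (fst x) (snd x) []} =
      prob ({x. snd x [] \<in> {Trap}} \<union> ?W)"
    by (intro arg_cong[where f = prob]) auto
  also have "\<dots> = prob {x. snd x [] \<in> {Trap}} + prob ?W"
    by (rule finite_measure_Union; (rule pred_sets_UNIV, measurable)?) auto
  also have "\<dots> = p + (1 - p - q) * win_prob n"
    unfolding prob_label_wins measure_root_label label_probs ..
  finally show ?thesis
    using prob_label_loses_Suc[of UNIV n] by simp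
qed

lemma win_prob_Suc: "win_prob (Suc n) = \<pi> - \<pi> * (1 - q - (1 - p - q) * loss_prob n) ^ d"
proof -
  let ?W = "{x. snd x [] \<in> {Safe} \<and> loses n (fst x) (snd x) []}"
  have ev: "{x. snd x [] = Target \<or> snd x [] = Safe \<and> loses n (fst x) (snd x) []} \<in> events"
      "{x. wins (Suc n) (fst x) (snd x) []} \<in> events"
    by (rule pred_sets_UNIV, measurable)+
  have "prob {x. snd x [] = Target \<or> snd x [] = Safe \<and> loses n (fst x) (snd x) []} =
      prob ({x. snd x [] \<in> {Target}} \<union> ?W)"
    by (intro arg_cong[where f = prob]) auto
  also have "\<dots> = prob {x. snd x [] \<in> {Target}} + prob ?W"
    by (rule finite_measure_Union; (rule pred_sets_UNIV, measurable)?) auto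
  also have "\<dots> = q + (1 - p - q) * loss_prob n"
    unfolding prob_label_loses measure_root_label label_probs ..
  finally have "prob {x. \<not> (snd x [] = Target \<or> snd x [] = Safe \<and> loses n (fst x) (snd x) [])} =
      1 - q - (1 - p - q) * loss_prob n"
    using prob_not[OF ev(1)] by simp
  then show ?thesis
    using prob_label_not_wins_Suc[of UNIV n] prob_not[OF ev(2)]
    by (simp del: wins.simps)
qed

lemma draw_event_eq:
  "draw_event offspring p q =
    - ((\<Union>n. {x. wins n (fst x) (snd x) []}) \<union> (\<Union>n. {x. loses n (fst x) (snd x) []}))"
  by (auto simp: draw_event_def space_game_space game_draw_def game_won_iff game_lost_iff)

lemma wins_event: "{x. wins n (fst x) (snd x) []} \<in> events"
  by (rule pred_sets_UNIV) measurable

lemma loses_event: "{x. loses n (fst x) (snd x) []} \<in> events"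
  by (rule pred_sets_UNIV) measurable

lemma draw_event_measurable: "draw_event offspring p q \<in> events"
proof -
  have "draw_event offspring p q = space G -
      ((\<Union>n. {x. wins n (fst x) (snd x) []}) \<union> (\<Union>n. {x. loses n (fst x) (snd x) []}))"
    by (simp add: draw_event_eq space_game_space Compl_eq_Diff_UNIV)
  then show ?thesis
    using wins_event loses_event by auto
qed

text \<open>The bounded events increase with \<open>n\<close>, so continuity from below applies; a
  win and a loss with different bounds are incompatible by passing to the larger bound.\<close>

lemma draw_prob_limit:
  "\<exists>W L. win_prob \<longlonglongrightarrow> W \<and> loss_prob \<longlonglongrightarrow> L \<and> prob (draw_event offspring p q) = 1 - W - L"
proof -
  let ?W = "\<lambda>n. {x. wins n (fst x) (snd x) []}" and ?L = "\<lambda>n. {x. loses n (fst x) (snd x) []}"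
  have "win_prob \<longlonglongrightarrow> prob (\<Union>n. ?W n)"
    using wins_event by (intro finite_Lim_measure_incseq) (auto simp: incseq_def intro: wins_mono)
  moreover have "loss_prob \<longlonglongrightarrow> prob (\<Union>n. ?L n)"
    using loses_event by (intro finite_Lim_measure_incseq) (auto simp: incseq_def intro: loses_mono)
  moreover have "prob (draw_event offspring p q) = 1 - prob (\<Union>n. ?W n) - prob (\<Union>n. ?L n)"
  proof -
    have ev: "(\<Union>n. ?W n) \<in> events" "(\<Union>n. ?L n) \<in> events"
      using wins_event loses_event by auto
    have disj: "(\<Union>n. ?W n) \<inter> (\<Union>n. ?L n) = {}"
    proof (rule ccontr)
      assume "\<not> ?thesis"
      then obtain x m n where "wins m (fst x) (snd x) []" "loses n (fst x) (snd x) []"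
        by auto
      then have "wins (max m n) (fst x) (snd x) []" "loses (max m n) (fst x) (snd x) []"
        using wins_mono loses_mono by (meson max.cobounded1 max.cobounded2)+
      then show False
        using not_wins_and_loses by blast
    qed
    have "prob (draw_event offspring p q) = 1 - prob ((\<Union>n. ?W n) \<union> (\<Union>n. ?L n))"
      using prob_compl[OF sets.Un[OF ev]]
      by (simp add: draw_event_eq space_game_space Compl_eq_Diff_UNIV)
    then show ?thesis
      using finite_measure_Union[OF ev disj] by simp
  qed
  ultimately show ?thesis by blast
qed

end

theorem theorem1p6:
  fixes d :: nat and \<pi> p q :: real and offspring :: "nat pmf"
  assumes "d \<ge> 2"
    and "0 < \<pi>" and "\<pi> < 1"
    and "pmf offspring 0 = 1 - \<pi>" and "pmf offspring d = \<pi>"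
    and "p \<in> {0..1}" and "q \<in> {0..1}"
    and "0 < p + q" and "p + q < 1"
  shows "draw_event offspring p q \<in> sets (game_space offspring p q) \<and>
    (measure (game_space offspring p q) (draw_event offspring p q) = 0 \<longleftrightarrow>
      (1 - p - q) * \<pi> * (\<pi> * (1 - q) + p * (1 - \<pi>)) ^ (d - 1)
        \<le> (real d + 1) ^ (d - 1) / real d ^ d)"
proof -
  interpret percolation_game offspring p q d \<pi>
    using assms by unfold_locales auto
  obtain W L where lim: "win_prob \<longlonglongrightarrow> W" "loss_prob \<longlonglongrightarrow> L"
    and draw: "prob (draw_event offspring p q) = 1 - W - L"
    using draw_prob_limit by blast
  define r where "r = 1 - p - q"
  have r: "r > 0" "r \<le> 1" using assms by (auto simp: r_def)
  define b where "b = r * \<pi>"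
  define c where "c = p + r * \<pi>"
  \<comment> \<open>A move to a given child loses within \<open>n\<close> further rounds with
    probability \<open>t n\<close>, and fails to win within them with probability
    \<open>s n\<close>.\<close>
  define s where "s n = 1 - q - r * loss_prob n" for n
  define t where "t n = p + r * win_prob n" for n
  have s0: "s 0 = 1 - q" and t0: "t 0 = p"
    by (simp_all add: s_def t_def)
  have "1 - q - r * L = p + r * W \<longleftrightarrow> b * c ^ (d - 1) \<le> (real d + 1) ^ (d - 1) / real d ^ d"
  proof (rule alternating_iteration_limits_eq_iff[where s = s and t = t])
    show "b > 0" using r assms by (simp add: b_def)
    show "s \<longlonglongrightarrow> 1 - q - r * L" "t \<longlonglongrightarrow> p + r * W"
      unfolding s_def t_def by (intro tendsto_intros lim)+
    show "s (Suc n) = c - b * t n ^ d" "t (Suc n) = c - b * s n ^ d" for n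
      unfolding s_def t_def b_def c_def loss_prob_Suc win_prob_Suc
      by (simp_all add: r_def algebra_simps)
    \<comment> \<open>Strictness at the lower end keeps the fixed point of the map away from
      \<open>p\<close>, leaving room for a 2-cycle below it.\<close>
    have "p ^ d < 1"
      using assms by (simp add: power_less_one_iff)
    then have "b * p ^ d < b"
      using \<open>b > 0\<close> by simp
    then show "t 0 < c - b * t 0 ^ d"
      by (simp add: t0 b_def c_def)
    have "b \<le> r"
      using r assms by (simp add: b_def)
    moreover have "b * p ^ d \<ge> 0"
      using \<open>b > 0\<close> assms by simp
    ultimately show "c - b * t 0 ^ d \<le> s 0"
      unfolding s0 t0 by (simp add: b_def c_def r_def)
    have "(1 - q) ^ d \<le> 1"
      using assms by (intro power_le_one) auto
    then have "b * (1 - q) ^ d \<le> b"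
      using \<open>b > 0\<close> by simp
    then show "t 0 \<le> c - b * s 0 ^ d"
      by (simp add: s0 t0 b_def c_def)
  qed (use assms in \<open>simp_all add: s0 t0\<close>)
  \<comment> \<open>The gap between the limits is \<open>r\<close> times the draw probability, and
    \<open>r > 0\<close>.\<close>
  moreover have "1 - q - r * L = p + r * W \<longleftrightarrow> r * (1 - W - L) = 0"
    by (auto simp: r_def algebra_simps)
  moreover have "c = \<pi> * (1 - q) + p * (1 - \<pi>)"
    by (simp add: c_def r_def algebra_simps)
  ultimately show ?thesis
    using draw_event_measurable draw r by (simp add: b_def r_def)
qed

end
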